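(* Let $P$ be a finite connected poset and $S,C\in\mathrm{Int}(P)$. Suppose that $\mathcal W(S,C)$ is nonempty. With respect to inclusion, it has a minimum and a maximum given by $$T_{\min}=S\cup C,\qquad T_{\max}=\operatorname{conv}\{x\mid T\in\mathcal W(S,C),\ x\in T\}.$$ Moreover, $$\partial_{T_{\min}}^+S=\mathrm{Max}(C\setminus S),\qquad\partial_{T_{\min}}^-C=\mathrm{Min}(S\setminus C),$$ $$\partial_{T_{\max}}^+S=\bigcup_{T\in\mathcal W(S,C)}\partial_T^+S,\qquad\partial_{T_{\max}}^-C=\bigcup_{T\in\mathcal W(S,C)}\partial_T^-C.$$ The assignment $$\mathcal W(S,C)\longrightarrow[\partial_{T_{\min}}^+S,\partial_{T_{\max}}^+S]\times[\partial_{T_{\min}}^-C,\partial_{T_{\max}}^-C],\qquad T\longmapsto(\partial_T^+S,\partial_T^-C),$$ is an isomorphism of posets, where the right-hand side has the product order induced by inclusion. In particular, $\mathcal W(S,C)$ is a Boolean lattice with rank function $$\operatorname{rk}_{S,C}(T)=\bigl|\partial_T^+S\setminus\partial_{T_{\min}}^+S\bigr|+\bigl|\partial_T^-C\setminus\partial_{T_{\min}}^-C\bigr|,$$ and for every $T\in\mathcal W(S,C)$, $$\omega(S,T,C)=|\mathrm{Max}(C\setminus S)|+|\mathrm{Min}(S\setminus C)|+\operatorname{rk}_{S,C}(T).$$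
   Context: A subset $S\subseteq P$ is connected if any $x,y\in S$ are joined by a sequence $x=x_0,\dots,x_r=y$ in $S$ with $x_{i-1},x_i$ comparable for all $i$; convex if $x,y\in S$ and $x\le z\le y$ imply $z\in S$; an interval if it is nonempty, connected and convex. $\mathrm{Int}(P)$ is the set of intervals of $P$. $\operatorname{conv}(X)$ is the smallest convex subset of $P$ containing $X$. For an interval $T$, a subset $C\subseteq T$ is a relative upset (resp. relative downset) in $T$ if $c\in C$, $x\in T$ and $c\le x$ (resp. $x\le c$) imply $x\in C$. $\mathcal U(T)$ (resp. $\mathcal D(T)$) is the set of intervals contained in $T$ that are relative upsets (resp. relative downsets) in $T$. $\mathrm{Min}(X)$, $\mathrm{Max}(X)$ are the sets of minimal and maximal elements of $X$, and $\lessdot_T$ is the covering relation in $T$. For $C\in\mathcal U(T)$, $\partial_T^-C=\{x\in T\setminus C\mid x\lessdot_Tc\text{ for some }c\in C\}$; $\Upsilon^-(P)$ is the set of pairs $(T,C)$ with $T\in\mathrm{Int}(P)$, $C\in\mathcal U(T)$, $\partial_T^-C=\mathrm{Min}(T\setminus C)$, and then $\omega^-(T,C)=|\partial_T^-C|$. For $S\in\mathcal D(T)$, $\partial_T^+S=\{x\in T\setminus S\mid s\lessdot_Tx\text{ for some }s\in S\}$; $\Upsilon^+(P)$ is the set of pairs $(S,T)$ with $T\in\mathrm{Int}(P)$, $S\in\mathcal D(T)$, $\partial_T^+S=\mathrm{Max}(T\setminus S)$, and then $\omega^+(S,T)=|\partial_T^+S|$. $\mathcal W(S,C)=\{T\in\mathrm{Int}(P)\mid(S,T)\in\Upsilon^+(P)\text{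 and }(T,C)\in\Upsilon^-(P)\}$, ordered by inclusion, and $\omega(S,T,C)=\omega^+(S,T)+\omega^-(T,C)$ for $T\in\mathcal W(S,C)$. For sets $X\subseteq Y$, $[X,Y]=\{Z\mid X\subseteq Z\subseteq Y\}$. *)

theory Defs
  imports "HOL-Algebra.Lattice" "HOL-Library.Product_Order" "HOL.Hull"
begin

text \<open>The poset \<open>P\<close> is the whole carrier of a type of class \<open>order\<close>.  Notions that are
  relative to a subset are stated for a subset of an arbitrary order, so that they apply both to
  sets \<open>T \<subseteq> P\<close> and, through the inclusion order on \<open>'a set\<close>, to families of intervals.\<close>

definition order_connected :: "'a::order set \<Rightarrow> bool" where
  "order_connected S \<longleftrightarrow>
     (\<forall>x\<in>S. \<forall>y\<in>S. (x, y) \<in> {(a, b). a \<in> S \<and> b \<in> S \<and> (a \<le> b \<or> b \<le> a)}\<^sup>*)"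

definition order_convex :: "'a::order set \<Rightarrow> bool" where
  "order_convex S \<longleftrightarrow> (\<forall>x\<in>S. \<forall>y\<in>S. \<forall>z. x \<le> z \<and> z \<le> y \<longrightarrow> z \<in> S)"

definition intervals :: "'a::order set set" where
  "intervals = {S. S \<noteq> {} \<and> order_connected S \<and> order_convex S}"

definition conv :: "'a::order set \<Rightarrow> 'a set" where
  "conv X = order_convex hull X"

definition minimals :: "'a::order set \<Rightarrow> 'a set" where
  "minimals X = {x \<in> X. \<not> (\<exists>y\<in>X. y < x)}"

definition maximals :: "'a::order set \<Rightarrow> 'a set" where
  "maximals X = {x \<in> X. \<not> (\<exists>y\<in>X. x < y)}"

definition covered_in :: "'a::order set \<Rightarrow> 'a \<Rightarrow> 'a \<Rightarrow> bool" where
  "covered_in T x y \<longleftrightarrow> x \<in> T \<and> y \<in> T \<and> x < y \<and> \<not> (\<exists>z\<in>T. x < z \<and> z < y)"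

definition upset_intervals :: "'a::order set \<Rightarrow> 'a set set" where
  "upset_intervals T =
     {C \<in> intervals. C \<subseteq> T \<and> (\<forall>c\<in>C. \<forall>x\<in>T. c \<le> x \<longrightarrow> x \<in> C)}"

definition downset_intervals :: "'a::order set \<Rightarrow> 'a set set" where
  "downset_intervals T =
     {S \<in> intervals. S \<subseteq> T \<and> (\<forall>s\<in>S. \<forall>x\<in>T. x \<le> s \<longrightarrow> x \<in> S)}"

text \<open>The first argument of both boundaries is the ambient interval: \<open>lower_bd T C\<close> is
  \<open>\<partial>\<close>-minus of \<open>C\<close> in \<open>T\<close>, and \<open>upper_bd T S\<close> is \<open>\<partial>\<close>-plus of \<open>S\<close> in \<open>T\<close>.\<close>

definition lower_bd :: "'a::order set \<Rightarrow> 'a set \<Rightarrow> 'a set" where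
  "lower_bd T C = {x \<in> T - C. \<exists>c\<in>C. covered_in T x c}"

definition upper_bd :: "'a::order set \<Rightarrow> 'a set \<Rightarrow> 'a set" where
  "upper_bd T S = {x \<in> T - S. \<exists>s\<in>S. covered_in T s x}"

definition Upsilon_minus :: "('a::order set \<times> 'a set) set" where
  "Upsilon_minus = {(T, C). T \<in> intervals \<and> C \<in> upset_intervals T \<and>
     lower_bd T C = minimals (T - C)}"

definition Upsilon_plus :: "('a::order set \<times> 'a set) set" where
  "Upsilon_plus = {(S, T). T \<in> intervals \<and> S \<in> downset_intervals T \<and>
     upper_bd T S = maximals (T - S)}"

definition omega_minus :: "'a::order set \<Rightarrow> 'a set \<Rightarrow> nat" where
  "omega_minus T C = card (lower_bd T C)"

definition omega_plus :: "'a::order set \<Rightarrow> 'a set \<Rightarrow> nat" where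
  "omega_plus S T = card (upper_bd T S)"

definition W :: "'a::order set \<Rightarrow> 'a set \<Rightarrow> 'a set set" where
  "W S C = {T \<in> intervals. (S, T) \<in> Upsilon_plus \<and> (T, C) \<in> Upsilon_minus}"

definition omega :: "'a::order set \<Rightarrow> 'a set \<Rightarrow> 'a set \<Rightarrow> nat" where
  "omega S T C = omega_plus S T + omega_minus T C"

definition T_min :: "'a::order set \<Rightarrow> 'a set \<Rightarrow> 'a set" where
  "T_min S C = S \<union> C"

definition T_max :: "'a::order set \<Rightarrow> 'a set \<Rightarrow> 'a set" where
  "T_max S C = conv {x. \<exists>T\<in>W S C. x \<in> T}"

definition rk :: "'a::order set \<Rightarrow> 'a set \<Rightarrow> 'a set \<Rightarrow> nat" where
  "rk S C T = card (upper_bd T S - upper_bd (T_min S C) S)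
            + card (lower_bd T C - lower_bd (T_min S C) C)"

definition poset_isomorphism :: "'a::order set \<Rightarrow> 'b::order set \<Rightarrow> ('a \<Rightarrow> 'b) \<Rightarrow> bool" where
  "poset_isomorphism A B f \<longleftrightarrow>
     bij_betw f A B \<and> (\<forall>x\<in>A. \<forall>y\<in>A. x \<le> y \<longleftrightarrow> f x \<le> f y)"

definition induced_order :: "'a::order set \<Rightarrow> 'a gorder" where
  "induced_order A = \<lparr>carrier = A, eq = (=), le = (\<le>)\<rparr>"

text \<open>A Boolean lattice is a bounded, distributive, complemented lattice.  Meets and joins are
  those of the induced order on \<open>A\<close>, not those of the surrounding type.\<close>

definition boolean_lattice_on :: "'a::order set \<Rightarrow> bool" where
  "boolean_lattice_on A \<longleftrightarrow> (let L = induced_order A in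
     bounded_lattice L \<and>
     (\<forall>x\<in>A. \<forall>y\<in>A. \<forall>z\<in>A. x \<sqinter>\<^bsub>L\<^esub> (y \<squnion>\<^bsub>L\<^esub> z) = (x \<sqinter>\<^bsub>L\<^esub> y) \<squnion>\<^bsub>L\<^esub> (x \<sqinter>\<^bsub>L\<^esub> z)) \<and>
     (\<forall>x\<in>A. \<exists>y\<in>A. x \<sqinter>\<^bsub>L\<^esub> y = \<bottom>\<^bsub>L\<^esub> \<and> x \<squnion>\<^bsub>L\<^esub> y = \<top>\<^bsub>L\<^esub>))"

definition rank_function_on :: "'a::order set \<Rightarrow> ('a \<Rightarrow> nat) \<Rightarrow> bool" where
  "rank_function_on A r \<longleftrightarrow>
     (\<forall>x\<in>minimals A. r x = 0) \<and>
     (\<forall>x\<in>A. \<forall>y\<in>A. covered_in A x y \<longrightarrow> r y = r x + 1)"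

end

theory Submission
  imports Defs
begin

text \<open>A pair of intervals \<open>(S, T)\<close> lies in \<open>Upsilon_plus\<close> iff \<open>S\<close> is a downset of \<open>T\<close>, every point of \<open>T - S\<close> lies
  below one that is above \<open>S\<close>, and the points of \<open>T - S\<close> above \<open>S\<close> are maximal in \<open>T - S\<close>; these points
  then form the boundary \<open>A\<close>. Dually for \<open>C\<close>, with boundary \<open>B\<close>. Hence a member \<open>T\<close> of \<open>W S C\<close> is
  recovered from its boundaries as the convex hull of \<open>S \<union> C \<union> A \<union> B\<close>. Conversely, for any choice of
  \<open>A\<close> and \<open>B\<close> between the boundaries in \<open>S \<union> C\<close> and the unions of all boundaries, this hull is in
  \<open>W S C\<close> and has boundaries \<open>A\<close> and \<open>B\<close>: a chain from \<open>S\<close> into some member can leave \<open>S\<close> only at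
  its last point, so boundary points taken from different members do not interfere.\<close>

section \<open>Boundary conditions and families for a parameter relation\<close>

text \<open>The relation is a parameter, so that statements about \<open>C\<close> are those about \<open>S\<close> for \<open>\<ge>\<close>.\<close>

definition above :: "('a \<Rightarrow> 'a \<Rightarrow> bool) \<Rightarrow> 'a set \<Rightarrow> 'a set \<Rightarrow> 'a set" where
  "above rel S T = {x \<in> T - S. \<exists>s\<in>S. rel s x}"

text \<open>The condition of \<open>Upsilon_plus\<close> freed of covers, so that it can be checked
  on a hull without knowing which pairs are covers there.\<close>

definition admissible :: "('a \<Rightarrow> 'a \<Rightarrow> bool) \<Rightarrow> 'a set \<Rightarrow> 'a set \<Rightarrow> bool" where
  "admissible rel S T \<longleftrightarrow> S \<subseteq> T \<and> (\<forall>s\<in>S. \<forall>x\<in>T. rel x s \<longrightarrow> x \<in> S) \<and>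
     (\<forall>x\<in>T - S. \<exists>a\<in>above rel S T. rel x a) \<and>
     (\<forall>x\<in>above rel S T. \<forall>y\<in>T - S. rel x y \<longrightarrow> x = y)"

text \<open>For a reflexive and transitive relation, one step of betweenness already yields the
  convex hull of \<open>V\<close>.\<close>

definition between :: "('a \<Rightarrow> 'a \<Rightarrow> bool) \<Rightarrow> 'a set \<Rightarrow> 'a set" where
  "between rel V = {z. \<exists>x\<in>V. \<exists>y\<in>V. rel x z \<and> rel z y}"

text \<open>Stands for \<open>W S C\<close> when \<open>S\<close> and \<open>C\<close> are
  intervals; connectedness is left out because it follows from that of \<open>S\<close>.\<close>

definition family :: "('a \<Rightarrow> 'a \<Rightarrow> bool) \<Rightarrow> 'a set \<Rightarrow> 'a set \<Rightarrow> 'a set set" where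
  "family rel S C = {T. between rel T \<subseteq> T \<and> admissible rel S T \<and> admissible (\<lambda>x y. rel y x) C T}"

lemma above_mono: "T \<subseteq> T' \<Longrightarrow> above rel S T \<subseteq> above rel S T'"
  by (auto simp: above_def)

lemma between_mono: "V \<subseteq> V' \<Longrightarrow> between rel V \<subseteq> between rel V'"
  unfolding between_def by blast

lemma between_dual: "between (\<lambda>x y. rel y x) V = between rel V"
  unfolding between_def by blast

lemma family_dual: "family (\<lambda>x y. rel y x) C S = family rel S C"
  unfolding family_def between_dual[of rel] by blast

lemma admissibleD:
  assumes "admissible rel S T"
  shows "S \<subseteq> T"
    and "\<And>s x. \<lbrakk>s \<in> S; x \<in> T; rel x s\<rbrakk> \<Longrightarrow> x \<in> S"
    and "\<And>x. \<lbrakk>x \<in> T; x \<notin> S\<rbrakk> \<Longrightarrow> \<exists>a\<in>above rel S T. rel x a"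
    and "\<And>x y. \<lbrakk>x \<in> above rel S T; y \<in> T; y \<notin> S; rel x y\<rbrakk> \<Longrightarrow> x = y"
  using assms unfolding admissible_def by blast+

lemma familyD:
  assumes "T \<in> family rel S C"
  shows "admissible rel S T" and "admissible (\<lambda>x y. rel y x) C T"
    and "\<And>x y z. \<lbrakk>x \<in> T; y \<in> T; rel x z; rel z y\<rbrakk> \<Longrightarrow> z \<in> T"
  using assms unfolding family_def between_def by blast+

section \<open>Boundaries, maximality and hulls in an abstract order\<close>

context ordering
begin

lemma finite_maximal:
  assumes "finite A" and "x \<in> A"
  shows "\<exists>m\<in>A. x \<^bold>\<le> m \<and> (\<forall>y\<in>A. \<not> m \<^bold>< y)"
proof -
  have "\<exists>m\<in>{y \<in> A. x \<^bold>\<le> y}. \<forall>y\<in>{y \<in> A. x \<^bold>\<le> y}. y \<noteq> m \<longrightarrow> \<not> m \<^bold>< y"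
    using assms refl
    by (intro Finite_Set.bex_max_element)
      (auto simp: asymp_on_def transp_on_def dest: asym intro: strict_trans)
  then show ?thesis
    by (metis (mono_tags, lifting) mem_Collect_eq order_iff_strict strict_iff_order trans)
qed

text \<open>A minimal point of \<open>above\<close> always belongs to \<open>cov\<close>. If all
  points of \<open>cov\<close> are maximal, no point of \<open>above\<close> lies strictly above a
  minimal one, so all its points are minimal. Conversely, maximality of all points of
  \<open>above\<close> makes each of them minimal there.\<close>

lemma admissible_iff:
  assumes "finite T" and "S \<subseteq> T" and down: "\<And>s x. \<lbrakk>s \<in> S; x \<in> T; x \<^bold>\<le> s\<rbrakk> \<Longrightarrow> x \<in> S"
  defines "cov \<equiv> {x \<in> T - S. \<exists>s\<in>S. s \<^bold>< x \<and> \<not> (\<exists>z\<in>T. s \<^bold>< z \<and> z \<^bold>< x)}"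
  shows "cov = {x \<in> T - S. \<not> (\<exists>y\<in>T - S. x \<^bold>< y)} \<longleftrightarrow> admissible (\<^bold>\<le>) S T"
    and "admissible (\<^bold>\<le>) S T \<Longrightarrow> cov = above (\<^bold>\<le>) S T"
proof -
  let ?max = "{x \<in> T - S. \<not> (\<exists>y\<in>T - S. x \<^bold>< y)}"
  interpret dual: ordering "\<lambda>x y. y \<^bold>\<le> x" "\<lambda>x y. y \<^bold>< x"
    by standard (auto intro: refl trans antisym simp: strict_iff_order)
  have cov_above: "cov \<subseteq> above (\<^bold>\<le>) S T"
    unfolding cov_def above_def by (auto intro: strict_implies_order)
  have covI: "x \<in> cov"
    if x: "x \<in> above (\<^bold>\<le>) S T" and min: "\<And>w. \<lbrakk>w \<in> above (\<^bold>\<le>) S T; w \<^bold>< x\<rbrakk> \<Longrightarrow> False" for x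
  proof -
    obtain s0 where s0: "s0 \<in> S" "s0 \<^bold>< x"
      using x unfolding above_def by (auto simp: strict_iff_order)
    \<comment> \<open>A maximal \<open>s\<close> of \<open>S\<close> below \<open>x\<close> is
      covered by \<open>x\<close>: a point strictly between would be in \<open>S\<close>, against
      the choice of \<open>s\<close>, or in \<open>above\<close>, against
      \<open>min\<close>.\<close>
    have "finite {s \<in> S. s \<^bold>< x}"
      using assms(1,2) by (auto intro: finite_subset)
    with finite_maximal[of _ s0] s0
    obtain s where s: "s \<in> S" "s \<^bold>< x" "\<And>y. \<lbrakk>y \<in> S; y \<^bold>< x\<rbrakk> \<Longrightarrow> \<not> s \<^bold>< y"
      by force
    have "\<not> (s \<^bold>< z \<and> z \<^bold>< x)" if "z \<in> T" for z
      using s min[of z] that unfolding above_def by (auto dest: strict_implies_order)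
    with x s show ?thesis unfolding cov_def above_def by blast
  qed
  have max_above: "above (\<^bold>\<le>) S T \<subseteq> ?max" if "admissible (\<^bold>\<le>) S T"
    using admissibleD(4)[OF that] by (auto simp: above_def strict_iff_order)
  show eq: "cov = above (\<^bold>\<le>) S T" if "admissible (\<^bold>\<le>) S T"
    using cov_above covI max_above[OF that] by (auto simp: above_def)
  show "cov = ?max \<longleftrightarrow> admissible (\<^bold>\<le>) S T"
  proof
    assume "admissible (\<^bold>\<le>) S T"
    moreover from this have "?max \<subseteq> above (\<^bold>\<le>) S T"
      by (force simp: strict_iff_order above_def dest!: admissibleD(3))
    ultimately show "cov = ?max" using eq max_above by blast
  next
    assume cm: "cov = ?max"
    have "x \<in> cov" if x: "x \<in> above (\<^bold>\<le>) S T" for x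
    proof -
      have "finite (above (\<^bold>\<le>) S T)" using assms(1) by (simp add: above_def)
      from dual.finite_maximal[OF this x]
      obtain w where w: "w \<in> above (\<^bold>\<le>) S T" "w \<^bold>\<le> x" "\<And>y. y \<in> above (\<^bold>\<le>) S T \<Longrightarrow> \<not> y \<^bold>< w"
        by blast
      then have "w \<in> ?max" using covI cm by blast
      then have "w = x" using w(2) x by (auto simp: above_def strict_iff_order)
      with covI w show ?thesis by blast
    qed
    with cov_above have eq: "above (\<^bold>\<le>) S T = ?max" using cm by blast
    show "admissible (\<^bold>\<le>) S T"
      unfolding admissible_def eq using assms(1,2) down finite_maximal[of "T - S"]
      by (force simp: strict_iff_order)
  qed
qed

text \<open>By convexity \<open>T\<close> need not be assumed to contain \<open>z\<close>, so the lemma also applies when \<open>z\<close> and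
  \<open>y\<close> come from different members of the family.\<close>

lemma family_above_maximal:
  assumes "T \<in> family (\<^bold>\<le>) S C" and "s \<in> S" "y \<in> T" "s \<^bold>\<le> z" "z \<^bold>\<le> y" "z \<notin> S"
  shows "z = y"
proof -
  note D = familyD[OF assms(1)]
  note A = admissibleD[OF D(1)]
  have "z \<in> T" using A(1) D(3)[of s y z] assms by blast
  then show ?thesis
    using A(2)[of y z] A(4)[of z y] assms by (auto simp: above_def)
qed

text \<open>Each generator in \<open>V\<close> lies in some member, and every member contains
  \<open>S \<union> C\<close>, so the conditions at a generator are read off in a member containing
  it. The dual order gives the same for \<open>C\<close> and \<open>Y\<close>.\<close>

lemma family_build:
  fixes S C X Y :: "'a set"
  defines "F \<equiv> family (\<^bold>\<le>) S C"
  defines "V \<equiv> S \<union> C \<union> X \<union> Y"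
  assumes ne: "F \<noteq> {}"
    and X: "above (\<^bold>\<le>) S (S \<union> C) \<subseteq> X" "X \<subseteq> (\<Union>T\<in>F. above (\<^bold>\<le>) S T)"
    and Y: "Y \<subseteq> (\<Union>T\<in>F. above (\<lambda>x y. y \<^bold>\<le> x) C T)"
  shows "admissible (\<^bold>\<le>) S (between (\<^bold>\<le>) V)" and "above (\<^bold>\<le>) S (between (\<^bold>\<le>) V) = X"
proof -
  let ?U = "between (\<^bold>\<le>) V"
  have V: "\<exists>T\<in>F. x \<in> T" if "x \<in> V" for x
  proof -
    obtain T where T: "T \<in> F" using ne by blast
    note D = familyD[OF T[unfolded F_def]]
    have "S \<union> C \<subseteq> T" using admissibleD(1)[OF D(1)] admissibleD(1)[OF D(2)] by blast
    then show ?thesis using that X(2) Y T by (auto simp: V_def above_def)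
  qed
  have VU: "V \<subseteq> ?U" unfolding between_def using refl by blast
  have down: "z \<in> S" if z: "x \<in> V" "x \<^bold>\<le> z" "z \<^bold>\<le> s" and s: "s \<in> S" for x z s
  proof -
    obtain T where T: "T \<in> F" "x \<in> T" using V z by blast
    note D = familyD[OF T(1)[unfolded F_def]]
    show ?thesis
      using admissibleD(1,2)[OF D(1)] D(3)[of x s z] T z s by blast
  qed
  have Xprop: "x \<notin> S \<and> (\<exists>s\<in>S. s \<^bold>\<le> x)" if "x \<in> X" for x
    using that X(2) by (auto simp: above_def)
  have max: "z = y" if "s \<in> S" "s \<^bold>\<le> z" "z \<notin> S" "z \<^bold>\<le> y" "y \<in> V" for s z y
    using V[OF that(5)] family_above_maximal that unfolding F_def by blast
  \<comment> \<open>A point of \<open>Y\<close> would lie on a chain from \<open>S\<close> up to a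
    point of \<open>C\<close> inside one member, and so equal that end by maximality, though
    \<open>Y\<close> avoids \<open>C\<close>.\<close>
  have VX: "y \<in> X" if y: "y \<in> V" "y \<notin> S" "s \<in> S" "s \<^bold>\<le> y" for s y
  proof -
    have False if yY: "y \<in> Y"
    proof -
      obtain T c where T: "T \<in> F" "y \<in> T" "y \<notin> C" "c \<in> C" "y \<^bold>\<le> c"
        using yY Y by (auto simp: above_def)
      then have "c \<in> T" using admissibleD(1)[OF familyD(2)[OF T(1)[unfolded F_def]]] by blast
      with family_above_maximal[of T S C s c y] T y show False unfolding F_def by blast
    qed
    with y X(1) show ?thesis unfolding V_def above_def by blast
  qed
  \<comment> \<open>\<open>z\<close> lies below a generator, and \<open>max\<close> makes the two
    equal; any hull point above \<open>z\<close> is squeezed the same way.\<close>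
  have maxU: "z \<in> X \<and> (\<forall>y\<in>?U. z \<^bold>\<le> y \<longrightarrow> z = y)"
    if z: "z \<in> ?U" "z \<notin> S" "s \<in> S" "s \<^bold>\<le> z" for z s
  proof -
    obtain y where y: "y \<in> V" "z \<^bold>\<le> y" using z unfolding between_def by blast
    have "z = y" using max z y by blast
    moreover have "z = u" if "u \<in> ?U" "z \<^bold>\<le> u" for u
    proof -
      obtain v where "v \<in> V" "u \<^bold>\<le> v" using \<open>u \<in> ?U\<close> unfolding between_def by blast
      moreover from this have "z = v" using max z \<open>z \<^bold>\<le> u\<close> trans by blast
      ultimately show ?thesis using \<open>z \<^bold>\<le> u\<close> antisym by blast
    qed
    ultimately show ?thesis using VX z y by blast
  qed
  show eq: "above (\<^bold>\<le>) S ?U = X"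
    using maxU Xprop VU unfolding above_def V_def by blast
  \<comment> \<open>In any member, an upper boundary point above \<open>c\<close> is again in
    \<open>C\<close>, since \<open>C\<close> is an upset there; so it is a point of
    \<open>above\<close> for \<open>S \<union> C\<close> and lies in \<open>X\<close>.\<close>
  have C: "\<exists>a\<in>X. c \<^bold>\<le> a" if c: "c \<in> C" "c \<notin> S" for c
  proof -
    obtain T where T: "T \<in> F" using ne by blast
    note D = familyD[OF T[unfolded F_def]]
    have "c \<in> T" using admissibleD(1)[OF D(2)] c by blast
    then obtain a where a: "a \<in> above (\<^bold>\<le>) S T" "c \<^bold>\<le> a"
      using admissibleD(3)[OF D(1)] c by blast
    then have "a \<in> C" using admissibleD(2)[OF D(2), of c a] c by (auto simp: above_def)
    with a X(1) show ?thesis by (auto simp: above_def)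
  qed
  have top: "\<exists>a\<in>X. z \<^bold>\<le> a" if z: "z \<in> ?U" "z \<notin> S" for z
  proof -
    obtain x y where xy: "x \<in> V" "y \<in> V" "x \<^bold>\<le> z" "z \<^bold>\<le> y"
      using z unfolding between_def by blast
    \<comment> \<open>A bound in \<open>Y\<close> is replaced by a point of \<open>C\<close> above
      it; a bound in \<open>S\<close> would put \<open>z\<close> into \<open>S\<close>.\<close>
    have "\<exists>y'\<in>C \<union> X. z \<^bold>\<le> y'"
    proof (cases "y \<in> Y")
      case True
      then obtain c where "c \<in> C" "y \<^bold>\<le> c" using Y by (auto simp: above_def)
      then show ?thesis using xy trans by blast
    next
      case False
      with xy z down show ?thesis unfolding V_def by blast
    qed
    then obtain y' where y': "y' \<in> C \<union> X" "z \<^bold>\<le> y'" by blast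
    then have "y' \<notin> S" using down xy z by blast
    with C y' show ?thesis using trans by blast
  qed
  show "admissible (\<^bold>\<le>) S ?U"
    unfolding admissible_def eq
  proof (intro conjI ballI impI)
    show "S \<subseteq> ?U" using VU unfolding V_def by blast
    show "x \<in> S" if "s \<in> S" "x \<in> ?U" "x \<^bold>\<le> s" for s x
      using that down unfolding between_def by blast
    show "\<exists>a\<in>X. x \<^bold>\<le> a" if "x \<in> ?U - S" for x using top that by blast
    show "x = y" if "x \<in> X" "y \<in> ?U - S" "x \<^bold>\<le> y" for x y
    proof -
      have "x \<in> ?U" using \<open>x \<in> X\<close> VU unfolding V_def by blast
      with maxU Xprop that show ?thesis by blast
    qed
  qed
qed

lemma between_between: "between (\<^bold>\<le>) (between (\<^bold>\<le>) V) \<subseteq> between (\<^bold>\<le>) V"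
  unfolding between_def using trans by blast

text \<open>A point of \<open>T\<close> outside \<open>S\<close> lies below some upper boundary
  point, and one outside \<open>C\<close> lies above some lower boundary point; points of
  \<open>S\<close> or \<open>C\<close> are generators themselves.\<close>

lemma family_eq_between:
  assumes "T \<in> family (\<^bold>\<le>) S C"
  shows "T = between (\<^bold>\<le>) (S \<union> C \<union> above (\<^bold>\<le>) S T \<union> above (\<lambda>x y. y \<^bold>\<le> x) C T)" (is "T = between _ ?V")
proof
  note D = familyD[OF assms]
  note A = admissibleD[OF D(1)] and B = admissibleD[OF D(2)]
  have "?V \<subseteq> T" using A(1) B(1) by (auto simp: above_def)
  then show "between (\<^bold>\<le>) ?V \<subseteq> T" using D(3) unfolding between_def by blast
  show "T \<subseteq> between (\<^bold>\<le>) ?V"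
  proof
    fix z assume "z \<in> T"
    then have "\<exists>y\<in>?V. z \<^bold>\<le> y" "\<exists>x\<in>?V. x \<^bold>\<le> z"
      using A(3)[of z] B(3)[of z] refl[of z] by blast+
    then show "z \<in> between (\<^bold>\<le>) ?V" unfolding between_def by blast
  qed
qed

end

section \<open>Intervals and \<open>W S C\<close> in terms of admissibility\<close>

lemma order_convex_iff_between: "order_convex T \<longleftrightarrow> between (\<le>) T \<subseteq> T"
  unfolding order_convex_def between_def by blast

text \<open>Both sides of the equivalence fail unless \<open>S\<close> is a relative downset in
  \<open>T\<close>; in that case \<open>admissible_iff\<close> applies.\<close>

lemma Upsilon_plus_iff:
  fixes S T :: "'a::{finite, order} set"
  shows "(S, T) \<in> Upsilon_plus \<longleftrightarrow> T \<in> intervals \<and> S \<in> intervals \<and> admissible (\<le>) S T"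
    and "admissible (\<le>) S T \<Longrightarrow> upper_bd T S = above (\<le>) S T"
proof -
  have cov: "upper_bd T S = {x \<in> T - S. \<exists>s\<in>S. s < x \<and> \<not> (\<exists>z\<in>T. s < z \<and> z < x)}" if "S \<subseteq> T"
    using that unfolding upper_bd_def covered_in_def by blast
  note iff = order.admissible_iff[of T S, OF finite]
  show "upper_bd T S = above (\<le>) S T" if "admissible (\<le>) S T"
    using cov iff(2) admissibleD(1,2)[OF that] that by metis
  show "(S, T) \<in> Upsilon_plus \<longleftrightarrow> T \<in> intervals \<and> S \<in> intervals \<and> admissible (\<le>) S T"
  proof (cases "S \<subseteq> T \<and> (\<forall>s\<in>S. \<forall>x\<in>T. x \<le> s \<longrightarrow> x \<in> S)")
    case True
    then show ?thesis
      using iff(1) cov unfolding Upsilon_plus_def downset_intervals_def maximals_def by auto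
  next
    case False
    then show ?thesis
      using admissibleD(1,2)[of "(\<le>)" S T] unfolding Upsilon_plus_def downset_intervals_def by blast
  qed
qed

lemma Upsilon_minus_iff:
  fixes C T :: "'a::{finite, order} set"
  shows "(T, C) \<in> Upsilon_minus \<longleftrightarrow> T \<in> intervals \<and> C \<in> intervals \<and> admissible (\<ge>) C T"
    and "admissible (\<ge>) C T \<Longrightarrow> lower_bd T C = above (\<ge>) C T"
proof -
  \<comment> \<open>The two inequalities on \<open>z\<close> are swapped to match the covering
    condition as read in the dual order.\<close>
  have cov: "lower_bd T C = {x \<in> T - C. \<exists>c\<in>C. x < c \<and> \<not> (\<exists>z\<in>T. z < c \<and> x < z)}" if "C \<subseteq> T"
    using that unfolding lower_bd_def covered_in_def by blast
  note iff = dual_order.admissible_iff[of T C, OF finite]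
  show "lower_bd T C = above (\<ge>) C T" if "admissible (\<ge>) C T"
    using cov iff(2) admissibleD(1,2)[OF that] that by metis
  show "(T, C) \<in> Upsilon_minus \<longleftrightarrow> T \<in> intervals \<and> C \<in> intervals \<and> admissible (\<ge>) C T"
  proof (cases "C \<subseteq> T \<and> (\<forall>c\<in>C. \<forall>x\<in>T. c \<le> x \<longrightarrow> x \<in> C)")
    case True
    then show ?thesis
      using iff(1) cov unfolding Upsilon_minus_def upset_intervals_def minimals_def by auto
  next
    case False
    then show ?thesis
      using admissibleD(1,2)[of "(\<ge>)" C T] unfolding Upsilon_minus_def upset_intervals_def by blast
  qed
qed

text \<open>Connectedness of \<open>T\<close> comes for free: every point of \<open>T - S\<close> lies below a point that lies
  above a point of \<open>S\<close>.\<close>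

lemma admissible_connected:
  assumes "admissible (\<le>) S T" and "order_connected S"
  shows "order_connected T"
proof -
  let ?R = "\<lambda>A. {(a, b). a \<in> A \<and> b \<in> A \<and> (a \<le> b \<or> b \<le> a)}"
  note A = admissibleD[OF assms(1)]
  have "sym (?R T)" by (auto simp: sym_def)
  then have sym: "sym ((?R T)\<^sup>*)" by (rule sym_rtrancl)
  have "?R S \<subseteq> ?R T" using A(1) by blast
  then have S: "(x, y) \<in> (?R T)\<^sup>*" if "x \<in> S" "y \<in> S" for x y
    using assms(2) that rtrancl_mono unfolding order_connected_def by blast
  have T: "\<exists>s\<in>S. (x, s) \<in> (?R T)\<^sup>*" if x: "x \<in> T" for x
  proof (cases "x \<in> S")
    case False
    then obtain a s where "a \<in> T" "s \<in> S" "x \<le> a" "s \<le> a"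
      using A(3) x unfolding above_def by blast
    then have "(x, a) \<in> ?R T" "(a, s) \<in> ?R T" using A(1) x by auto
    then have "(x, s) \<in> (?R T)\<^sup>*" by (meson rtrancl.simps)
    with \<open>s \<in> S\<close> show ?thesis by blast
  qed auto
  show ?thesis
    unfolding order_connected_def
  proof (intro ballI)
    fix x y assume "x \<in> T" "y \<in> T"
    then obtain s t where "s \<in> S" "t \<in> S" "(x, s) \<in> (?R T)\<^sup>*" "(y, t) \<in> (?R T)\<^sup>*"
      using T by blast
    then show "(x, y) \<in> (?R T)\<^sup>*" using S sym by (meson rtrancl_trans symD)
  qed
qed

text \<open>Members of the family are nonempty because they contain \<open>S\<close>, convex by the
  \<open>between\<close> clause and connected by \<open>admissible_connected\<close>.\<close>

lemma W_eq_family: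
  fixes S C :: "'a::{finite, order} set"
  assumes "S \<in> intervals" and "C \<in> intervals"
  shows "W S C = family (\<le>) S C"
proof -
  have "T \<in> intervals" if "T \<in> family (\<le>) S C" for T
    using familyD(1)[OF that] that assms admissible_connected[of S T] admissibleD(1)[of "(\<le>)" S T]
    unfolding intervals_def family_def order_convex_iff_between by blast
  moreover have "T \<in> family (\<le>) S C" if "T \<in> W S C" for T
    using that unfolding W_def Upsilon_plus_iff(1) Upsilon_minus_iff(1)
    by (simp add: family_def intervals_def order_convex_iff_between)
  ultimately show ?thesis
    using assms familyD(1,2) unfolding W_def Upsilon_plus_iff(1) Upsilon_minus_iff(1) by blast
qed

section \<open>Boolean lattices transported along poset isomorphisms\<close>

text \<open>Closure under \<open>inf\<close> and \<open>sup\<close> makes \<open>B\<close> a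
  sublattice of a distributive lattice, so meets and joins in \<open>A\<close> are explicit images
  under the inverse of \<open>f\<close>, and distributivity is inherited.\<close>

lemma boolean_lattice_on_isomorphic:
  fixes A :: "'a::order set" and B :: "'b::distrib_lattice set"
  assumes iso: "poset_isomorphism A B f"
    and inf: "\<And>x y. \<lbrakk>x \<in> B; y \<in> B\<rbrakk> \<Longrightarrow> inf x y \<in> B"
    and sup: "\<And>x y. \<lbrakk>x \<in> B; y \<in> B\<rbrakk> \<Longrightarrow> sup x y \<in> B"
    and l: "l \<in> B" "\<And>x. x \<in> B \<Longrightarrow> l \<le> x"
    and h: "h \<in> B" "\<And>x. x \<in> B \<Longrightarrow> x \<le> h"
    and compl: "\<And>x. x \<in> B \<Longrightarrow> \<exists>y\<in>B. inf x y = l \<and> sup x y = h"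
  shows "boolean_lattice_on A"
proof -
  let ?L = "induced_order A"
  have bij: "bij_betw f A B" and le: "\<And>x y. \<lbrakk>x \<in> A; y \<in> A\<rbrakk> \<Longrightarrow> x \<le> y \<longleftrightarrow> f x \<le> f y"
    using iso unfolding poset_isomorphism_def by auto
  define g where "g = inv_into A f"
  have fB: "\<And>x. x \<in> A \<Longrightarrow> f x \<in> B" and gA: "\<And>y. y \<in> B \<Longrightarrow> g y \<in> A"
    and fg: "\<And>y. y \<in> B \<Longrightarrow> f (g y) = y"
    using bij unfolding g_def bij_betw_def by (auto intro: inv_into_into f_inv_into_f)
  have simps: "carrier ?L = A" "eq ?L = (=)" "gorder.le ?L = (\<le>)"
    by (simp_all add: induced_order_def)
  interpret partial_order ?L
    by standard (auto simp: simps)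
  have glb: "greatest ?L (g (inf (f x) (f y))) (Lower ?L {x, y})"
    and lub: "least ?L (g (sup (f x) (f y))) (Upper ?L {x, y})" if "x \<in> A" "y \<in> A" for x y
    using that inf[OF fB fB, of x y] sup[OF fB fB, of x y]
    by (auto simp: greatest_def least_def Lower_def Upper_def simps le gA fg)
  have bot: "least ?L (g l) (carrier ?L)" and top: "greatest ?L (g h) (carrier ?L)"
    using l h by (auto simp: least_def greatest_def simps le gA fg fB)
  \<comment> \<open>Meets, joins and bounds of the record are \<open>SOME\<close> choices;
    uniqueness in a partial order pins them to the transported elements.\<close>
  have greatest_some: "(SOME z. greatest ?L z M) = u" if "greatest ?L u M" for u M
    using that greatest_unique by (metis someI)
  have least_some: "(SOME z. least ?L z M) = u" if "least ?L u M" for u M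
    using that least_unique by (metis someI)
  interpret bounded_lattice ?L
  proof
    fix x y assume "x \<in> carrier ?L" "y \<in> carrier ?L"
    then show "\<exists>s. least ?L s (Upper ?L {x, y})" "\<exists>s. greatest ?L s (Lower ?L {x, y})"
      using glb lub simps by blast+
  qed (use bot top in blast)+
  have meet: "x \<sqinter>\<^bsub>?L\<^esub> y = g (inf (f x) (f y))" and join: "x \<squnion>\<^bsub>?L\<^esub> y = g (sup (f x) (f y))"
    if "x \<in> A" "y \<in> A" for x y
    using greatest_some[OF glb[OF that]] least_some[OF lub[OF that]]
    unfolding meet_def join_def inf_def sup_def by simp_all
  have "\<bottom>\<^bsub>?L\<^esub> = g l" "\<top>\<^bsub>?L\<^esub> = g h"
    using least_some[OF bot] greatest_some[OF top] unfolding bottom_def top_def by simp_all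
  moreover have "\<exists>y\<in>A. x \<sqinter>\<^bsub>?L\<^esub> y = g l \<and> x \<squnion>\<^bsub>?L\<^esub> y = g h" if x: "x \<in> A" for x
  proof -
    obtain z where "z \<in> B" "inf (f x) z = l" "sup (f x) z = h" using compl fB x by blast
    then show ?thesis using x by (intro bexI[of _ "g z"]) (auto simp: meet join gA fg)
  qed
  ultimately show ?thesis
    unfolding boolean_lattice_on_def Let_def
    using bounded_lattice_axioms
    by (auto simp: meet join gA fB fg inf sup inf_sup_distrib1)
qed

lemma boolean_lattice_on_interval_product:
  fixes A :: "'a::order set" and a b :: "'b set" and c d :: "'c set"
  assumes iso: "poset_isomorphism A ({a..b} \<times> {c..d}) f" and "a \<subseteq> b" "c \<subseteq> d"
  shows "boolean_lattice_on A"
proof (rule boolean_lattice_on_isomorphic[OF iso, of "(a, c)" "(b, d)"])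
  fix x assume "x \<in> {a..b} \<times> {c..d}"
  \<comment> \<open>The complement of \<open>X\<close> in the interval from \<open>a\<close> to
    \<open>b\<close> is \<open>a \<union> (b - X)\<close>; adding \<open>a\<close> keeps it inside
    the interval.\<close>
  then show "\<exists>y\<in>{a..b} \<times> {c..d}. inf x y = (a, c) \<and> sup x y = (b, d)"
    using assms(2,3)
    by (intro bexI[of _ "(a \<union> (b - fst x), c \<union> (d - snd x))"]) auto
qed (use assms(2,3) in auto)

section \<open>Description of \<open>W S C\<close> by pairs of boundaries\<close>

theorem proposition6p1:
  fixes S C :: "'a::{finite, order} set"
  assumes "order_connected (UNIV :: 'a set)"
    and "S \<in> intervals" and "C \<in> intervals"
    and "W S C \<noteq> {}"
  shows "T_min S C \<in> W S C \<and> (\<forall>T\<in>W S C. T_min S C \<subseteq> T)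
    \<and> T_max S C \<in> W S C \<and> (\<forall>T\<in>W S C. T \<subseteq> T_max S C)
    \<and> upper_bd (T_min S C) S = maximals (C - S)
    \<and> lower_bd (T_min S C) C = minimals (S - C)
    \<and> upper_bd (T_max S C) S = (\<Union>T\<in>W S C. upper_bd T S)
    \<and> lower_bd (T_max S C) C = (\<Union>T\<in>W S C. lower_bd T C)
    \<and> poset_isomorphism (W S C)
        ({upper_bd (T_min S C) S .. upper_bd (T_max S C) S} \<times>
         {lower_bd (T_min S C) C .. lower_bd (T_max S C) C})
        (\<lambda>T. (upper_bd T S, lower_bd T C))
    \<and> boolean_lattice_on (W S C)
    \<and> rank_function_on (W S C) (rk S C)
    \<and> (\<forall>T\<in>W S C.
         omega S T C = card (maximals (C - S)) + card (minimals (S - C)) + rk S C T)"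
proof -
  let ?W = "W S C"
  define A where "A = (\<lambda>T. above (\<le>) S T)"
  define B where "B = (\<lambda>T. above (\<ge>) C T)"
  define U where "U = (\<lambda>X Y. between (\<le>) (S \<union> C \<union> X \<union> Y))"
  \<comment> \<open>\<open>a\<close> and \<open>b\<close> are the boundaries in
    \<open>S \<union> C\<close>, \<open>a'\<close> and \<open>b'\<close> the unions of all
    boundaries; they become the ends of the two intervals.\<close>
  define a where "a = A (S \<union> C)"
  define b where "b = B (S \<union> C)"
  define a' where "a' = (\<Union>T\<in>?W. A T)"
  define b' where "b' = (\<Union>T\<in>?W. B T)"
  note Wf = W_eq_family[OF assms(2,3)]
  have adm: "admissible (\<le>) S T" "admissible (\<ge>) C T" if "T \<in> ?W" for T
    using familyD that unfolding Wf by blast+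
  have min: "S \<union> C \<subseteq> T" if "T \<in> ?W" for T
    using admissibleD(1) adm that by blast
  have mono: "A T \<subseteq> A T'" "B T \<subseteq> B T'" if "T \<subseteq> T'" for T T'
    using that above_mono unfolding A_def B_def by blast+
  have U_mono: "U X Y \<subseteq> U X' Y'" if "X \<subseteq> X'" "Y \<subseteq> Y'" for X X' Y Y'
    unfolding U_def using that by (intro between_mono) blast
  have rng: "a \<subseteq> A T" "A T \<subseteq> a'" "b \<subseteq> B T" "B T \<subseteq> b'" if "T \<in> ?W" for T
    using that mono[OF min[OF that]] unfolding a_def b_def a'_def b'_def by auto
  have ab: "a \<subseteq> a'" "b \<subseteq> b'" using rng assms(4) by blast+
  \<comment> \<open>\<open>family_build\<close> is used for \<open>S\<close> with \<le> and for
    \<open>C\<close> with \<ge>, the arguments exchanged; with convexity of the hull this gives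
    membership.\<close>
  have U: "U X Y \<in> ?W" "A (U X Y) = X" "B (U X Y) = Y"
    if XY: "a \<subseteq> X" "X \<subseteq> a'" "b \<subseteq> Y" "Y \<subseteq> b'" for X Y
  proof -
    have U': "between (\<ge>) (C \<union> S \<union> Y \<union> X) = U X Y"
      unfolding U_def between_dual[of "(\<le>)"] by (simp only: Un_ac)
    have dual: "family (\<ge>) C S = ?W" unfolding Wf by (rule family_dual)
    have "admissible (\<le>) S (U X Y)" "A (U X Y) = X"
      unfolding U_def A_def
      by (rule order.family_build;
          use XY assms(4) in \<open>simp add: Wf[symmetric] a_def a'_def b'_def A_def B_def\<close>)+
    moreover have "admissible (\<ge>) C (U X Y)" "B (U X Y) = Y"
      unfolding U'[symmetric] B_def
      by (rule dual_order.family_build;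
          use XY assms(4) in \<open>simp add: dual b_def a'_def b'_def A_def B_def Un_commute\<close>)+
    moreover have "between (\<le>) (U X Y) \<subseteq> U X Y"
      unfolding U_def by (rule order.between_between)
    ultimately show "U X Y \<in> ?W" "A (U X Y) = X" "B (U X Y) = Y"
      unfolding Wf family_def by auto
  qed
  have eqU: "T = U (A T) (B T)" if "T \<in> ?W" for T
    using order.family_eq_between that unfolding Wf U_def A_def B_def by blast
  have SC: "S \<union> C = U a b"
  proof
    have Uab: "U a b \<in> ?W" using U(1) ab by blast
    then show "S \<union> C \<subseteq> U a b" by (rule min)
    have "a \<subseteq> S \<union> C" "b \<subseteq> S \<union> C" unfolding a_def b_def A_def B_def above_def by auto
    then have V: "S \<union> C \<union> a \<union> b = S \<union> C" by blast
    show "U a b \<subseteq> S \<union> C"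
    proof
      fix z assume z: "z \<in> U a b"
      then obtain x y where xy: "x \<in> S \<union> C" "y \<in> S \<union> C" "x \<le> z" "z \<le> y"
        unfolding U_def V between_def by blast
      \<comment> \<open>If \<open>x\<close> is in \<open>C\<close> or \<open>y\<close> in
        \<open>S\<close>, the upset or downset property decides; otherwise \<open>z\<close> lies
        between \<open>S\<close> and \<open>C\<close>, so it is in \<open>S\<close> or equals
        \<open>y\<close>.\<close>
      note Uf = Uab[unfolded Wf]
      have "y \<in> U a b" using xy min[OF Uab] by blast
      then show "z \<in> S \<union> C"
        using xy z admissibleD(2)[OF adm(1)[OF Uab]] admissibleD(2)[OF adm(2)[OF Uab]]
          order.family_above_maximal[OF Uf, of x y z] by blast
    qed
  qed
  have Tmin: "T_min S C = U a b" using SC unfolding T_min_def by simp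
  have max: "T \<subseteq> U a' b'" if "T \<in> ?W" for T
    using eqU[OF that] U_mono rng[OF that] by metis
  have Umin: "U a b \<in> ?W" and Umax: "U a' b' \<in> ?W" using U(1) ab by blast+
  have Tmax: "T_max S C = U a' b'"
  proof -
    \<comment> \<open>The union of all members is itself the member \<open>U a' b'\<close>, so
      taking \<open>conv\<close> adds nothing.\<close>
    have un: "{x. \<exists>T\<in>?W. x \<in> T} = U a' b'" using max Umax by blast
    have "order_convex (U a' b')"
      unfolding order_convex_iff_between U_def by (rule order.between_between)
    then show ?thesis unfolding T_max_def conv_def un by (rule hull_same)
  qed
  have upper: "upper_bd T S = A T" and lower: "lower_bd T C = B T" if "T \<in> ?W" for T
    using adm[OF that] Upsilon_plus_iff(2) Upsilon_minus_iff(2) unfolding A_def B_def by blast+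
  have bd_min: "upper_bd (T_min S C) S = a" "lower_bd (T_min S C) C = b"
    using upper lower Umin U(2,3) ab unfolding Tmin by auto
  have bd_max: "upper_bd (T_max S C) S = a'" "lower_bd (T_max S C) C = b'"
    using upper lower Umax U(2,3) ab unfolding Tmax by auto
  have "(S, S \<union> C) \<in> Upsilon_plus" "(S \<union> C, C) \<in> Upsilon_minus"
    using Umin unfolding SC W_def by blast+
  then have "upper_bd (S \<union> C) S = maximals (S \<union> C - S)" "lower_bd (S \<union> C) C = minimals (S \<union> C - C)"
    unfolding Upsilon_plus_def Upsilon_minus_def by blast+
  moreover have "S \<union> C - S = C - S" "S \<union> C - C = S - C" by blast+
  ultimately have ext: "a = maximals (C - S)" "b = minimals (S - C)"
    using bd_min unfolding T_min_def by simp_all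
  \<comment> \<open>Monotonicity of the boundaries gives one direction, that of the hull the other,
    since each member is the hull determined by its boundaries.\<close>
  have le: "T \<subseteq> T' \<longleftrightarrow> A T \<subseteq> A T' \<and> B T \<subseteq> B T'" if "T \<in> ?W" "T' \<in> ?W" for T T'
    using mono U_mono eqU that by metis
  let ?f = "\<lambda>T. (upper_bd T S, lower_bd T C)"
  have iso: "poset_isomorphism ?W ({a..a'} \<times> {b..b'}) ?f"
    unfolding poset_isomorphism_def
  proof
    show "\<forall>T\<in>?W. \<forall>T'\<in>?W. T \<le> T' \<longleftrightarrow> ?f T \<le> ?f T'"
      using le upper lower by simp
    show "bij_betw ?f ?W ({a..a'} \<times> {b..b'})"
      by (rule bij_betw_byWitness[where f' = "\<lambda>(X, Y). U X Y"])
        (use U rng upper lower eqU in auto)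
  qed
  have rk: "rk S C T = card (A T - a) + card (B T - b)" if "T \<in> ?W" for T
    using upper[OF that] lower[OF that] bd_min unfolding rk_def by simp
  have rank: "rank_function_on ?W (rk S C)"
    unfolding rank_function_on_def
  proof (intro conjI ballI impI)
    fix T assume "T \<in> minimals ?W"
    then have "T = U a b" using Umin min unfolding minimals_def SC by blast
    then show "rk S C T = 0" using rk[OF Umin] U(2,3) ab by simp
  next
    fix T T' assume T: "T \<in> ?W" "T' \<in> ?W" and cov: "covered_in ?W T T'"
    have "T \<subset> T'" using cov unfolding covered_in_def by blast
    then have sub: "A T \<subseteq> A T'" "B T \<subseteq> B T'" and ne: "T \<noteq> T'"
      using mono[of T T'] by blast+
    note r = rng[OF T(1)] rng[OF T(2)]
    \<comment> \<open>A pair strictly above that of \<open>T\<close> and below that of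
      \<open>T'\<close> or equal to it is realised by a member between \<open>T\<close> and
      \<open>T'\<close>, which the covering forces to be \<open>T'\<close>.\<close>
    have step: "X = A T' \<and> Y = B T'"
      if XY: "A T \<subseteq> X" "X \<subseteq> A T'" "B T \<subseteq> Y" "Y \<subseteq> B T'" "X \<noteq> A T \<or> Y \<noteq> B T" for X Y
    proof -
      have "a \<subseteq> X" "X \<subseteq> a'" "b \<subseteq> Y" "Y \<subseteq> b'" using XY r by (blast intro: subset_trans)+
      then have UXY: "U X Y \<in> ?W" "A (U X Y) = X" "B (U X Y) = Y" by (fact U)+
      then have "T \<subseteq> U X Y" "U X Y \<subseteq> T'" "U X Y \<noteq> T" using le T XY by auto
      then have "U X Y = T'" using cov UXY(1) unfolding covered_in_def by blast
      then show ?thesis using UXY by blast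
    qed
    have card: "card (insert e Z - z) = card (Z - z) + 1" if "e \<notin> Z" "z \<subseteq> Z" for e :: 'a and Z z
    proof -
      have "insert e Z - z = insert e (Z - z)" using that by blast
      then show ?thesis using that by simp
    qed
    \<comment> \<open>One new boundary point \<open>e\<close> suffices: by \<open>step\<close>, the
      pair of \<open>T'\<close> is that of \<open>T\<close> with \<open>e\<close> inserted on one
      side, so the rank grows by exactly one.\<close>
    have "A T \<noteq> A T' \<or> B T \<noteq> B T'" using ne eqU T by metis
    then consider e where "e \<in> A T'" "e \<notin> A T" | e where "e \<in> B T'" "e \<notin> B T"
      using sub by blast
    then show "rk S C T' = rk S C T + 1"
    proof cases
      case 1
      then have "insert e (A T) = A T' \<and> B T = B T'" using sub by (intro step) auto
      then show ?thesis using card[OF 1(2) r(1)] rk T by simp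
    next
      case 2
      then have "A T = A T' \<and> insert e (B T) = B T'" using sub by (intro step) auto
      then show ?thesis using card[OF 2(2) r(3)] rk T by simp
    qed
  qed
  have om: "omega S T C = card a + card b + rk S C T" if "T \<in> ?W" for T
  proof -
    have "card (A T) = card a + card (A T - a)" "card (B T) = card b + card (B T - b)"
      using rng[OF that] by (simp_all add: card_Diff_subset card_mono)
    then show ?thesis
      using upper[OF that] lower[OF that] rk[OF that]
      unfolding omega_def omega_plus_def omega_minus_def by simp
  qed
  have unions: "a' = (\<Union>T\<in>?W. upper_bd T S)" "b' = (\<Union>T\<in>?W. lower_bd T C)"
    using upper lower unfolding a'_def b'_def by auto
  show ?thesis
    using Umin Umax max min iso rank om boolean_lattice_on_interval_product[OF iso ab]
    unfolding bd_min bd_max unfolding Tmin Tmax SC ext[symmetric] unions[symmetric] by blast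
qed

end
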